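(* Let $P(v,x,y,z)$ be the generating function in which the coefficient of $v^kx^ry^dz^n$ is the number of plane trees with $n$ edges and $k$ leaves whose $r$th leaf has depth $d$. Then $$P(v,x,y,z)=\frac{v}{1-yz\left(N(vx,z)-vx+1\right)\left(N(v,z)-v+1\right)}.$$
   Context: Plane trees are rooted trees where each node can have an arbitrary number of children, which are linearly ordered. A leaf is a node with no children (the tree with a single node has one leaf, its root). The leaves are ordered from left to right (the relative order of two leaves is determined by comparing, in the left-to-right order of children, the paths from the root at the first place where they disagree) and are indexed starting at $0$, so that the leftmost leaf is the $0$th leaf. The depth of a node is the number of edges in the path from the root to it. $N(v,z)$ denotes the bivariate generating function for plane trees where $v$ marks the number of leaves and $z$ marks the number of edges: $$N(v,z)=\frac{1-(1-v)z-\sqrt{1-2(1+v)z+(1-v)^2z^2}}{2z}=v+\sum_{n\ge1}\sum_{k=1}^n \frac1n\binom{n}{k}\binom{n}{k-1} v^kz^n .$$ *)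

theory Defs
  imports
    "HOL-Computational_Algebra.Formal_Power_Series"
    "HOL-Library.List_Lexorder"
begin

section \<open>Plane trees\<close>

datatype plane_tree = Node (children: "plane_tree list")

text \<open>
  A node is identified with its address, i.e. the list of child indices (counted from 0, left to
  right) read along the path from the root. The root is \<open>[]\<close>, and the children of \<open>p\<close> are the nodes
  of the form \<open>p @ [i]\<close>.
\<close>

primrec is_node :: "nat list \<Rightarrow> plane_tree \<Rightarrow> bool" where
  "is_node [] t \<longleftrightarrow> True"
| "is_node (i # p) t \<longleftrightarrow> i < length (children t) \<and> is_node p (children t ! i)"

definition nodes :: "plane_tree \<Rightarrow> nat list set" where
  "nodes t = {p. is_node p t}"

definition edges :: "plane_tree \<Rightarrow> (nat list \<times> nat list) set" where
  "edges t = {(p, q). p \<in> nodes t \<and> q \<in> nodes t \<and> (\<exists>i. q = p @ [i])}"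

definition leaves :: "plane_tree \<Rightarrow> nat list set" where
  "leaves t = {p \<in> nodes t. \<forall>i. p @ [i] \<notin> nodes t}"

definition num_edges :: "plane_tree \<Rightarrow> nat" where
  "num_edges t = card (edges t)"

definition num_leaves :: "plane_tree \<Rightarrow> nat" where
  "num_leaves t = card (leaves t)"

definition depth :: "nat list \<Rightarrow> nat" where
  "depth p = length p"

text \<open>
  The order on addresses is the lexicographic one; as no leaf is a proper prefix of another leaf,
  it compares two leaves at the first place where their addresses disagree. The value is
  meaningful for \<open>r < num_leaves t\<close> only.
\<close>

definition nth_leaf :: "plane_tree \<Rightarrow> nat \<Rightarrow> nat list" where
  "nth_leaf t r = sorted_list_of_set (leaves t) ! r"


section \<open>Generating functions\<close>

text \<open>
  The ring of formal power series in \<open>v\<close>, \<open>x\<close>, \<open>y\<close>, \<open>z\<close> over the rationals is represented as the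
  iterated ring \<open>\<rat>[[v]][[x]][[y]][[z]]\<close>, so that the coefficient of \<open>v\<^sup>k x\<^sup>r y\<^sup>d z\<^sup>n\<close> in \<open>F\<close> is
  \<open>F $ n $ d $ r $ k\<close>, where \<open>$\<close> is \<^const>\<open>fps_nth\<close>.
\<close>

type_synonym coeff_vxy = "rat fps fps fps"
type_synonym series_vxyz = "coeff_vxy fps"

definition var_v :: coeff_vxy where "var_v = fps_const (fps_const fps_X)"
definition var_x :: coeff_vxy where "var_x = fps_const fps_X"
definition var_y :: coeff_vxy where "var_y = fps_X"

text \<open>
  \<open>N u\<close> is \<open>N(u, z)\<close>, a series in \<open>z\<close>. The coefficient of each power of \<open>z\<close> in \<open>N(v, z)\<close> is
  a polynomial in \<open>v\<close>, so any element \<open>u\<close> of the coefficient ring may be substituted for \<open>v\<close>,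
  in particular \<open>v x\<close>.
\<close>

definition N :: "'a::comm_ring_1 \<Rightarrow> 'a fps" where
  "N u = Abs_fps (\<lambda>n. \<Sum>t | num_edges t = n. u ^ num_leaves t)"

definition P :: series_vxyz where
  "P = Abs_fps (\<lambda>n. Abs_fps (\<lambda>d. Abs_fps (\<lambda>r. Abs_fps (\<lambda>k.
     of_nat (card {t. num_edges t = n \<and> num_leaves t = k \<and>
                      r < k \<and> depth (nth_leaf t r) = d})))))"


section \<open>Basic properties\<close>

context includes fps_syntax
begin

lemma nodes_Node: "nodes (Node ts) = insert [] (\<Union>i<length ts. (#) i ` nodes (ts ! i))"
proof (rule set_eqI)
  fix p show "p \<in> nodes (Node ts) \<longleftrightarrow> p \<in> insert [] (\<Union>i<length ts. (#) i ` nodes (ts ! i))"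
    by (cases p) (auto simp: nodes_def)
qed

lemma Nil_in_nodes [simp]: "[] \<in> nodes t" by (simp add: nodes_def)

lemma Cons_in_nodes [simp]: "i # p \<in> nodes (Node ts) \<longleftrightarrow> i < length ts \<and> p \<in> nodes (ts ! i)"
  by (simp add: nodes_def)

lemma prefix_in_nodes: "p @ q \<in> nodes t \<Longrightarrow> p \<in> nodes t"
  by (induction p arbitrary: t) (auto simp: nodes_def)

lemma finite_nodes: "finite (nodes t)"
  by (induction t) (simp add: nodes_Node)

lemma finite_leaves: "finite (leaves t)"
  unfolding leaves_def by (rule finite_subset[OF _ finite_nodes]) auto

lemma card_UN_Cons:
  fixes n :: nat
  assumes "\<And>i. i < n \<Longrightarrow> finite (A i)"
  shows "card (\<Union>i<n. (#) i ` A i) = (\<Sum>i<n. card (A i))"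
proof -
  have "card (\<Union>i\<in>{..<n}. (#) i ` A i) = (\<Sum>i<n. card ((#) i ` A i))"
    by (rule card_UN_disjoint) (use assms in auto)
  thus ?thesis by (simp add: card_image)
qed

lemma num_edges_nodes: "Suc (num_edges t) = card (nodes t)"
proof -
  have "bij_betw snd (edges t) (nodes t - {[]})"
  proof (rule bij_betwI[where g = "\<lambda>q. (butlast q, q)"])
    show "(\<lambda>q. (butlast q, q)) \<in> nodes t - {[]} \<rightarrow> edges t"
      by (auto simp: edges_def) (metis append_butlast_last_id prefix_in_nodes)+
  qed (auto simp: edges_def)
  hence "num_edges t = card (nodes t - {[]})"
    unfolding num_edges_def by (rule bij_betw_same_card)
  thus ?thesis using finite_nodes[of t] card_Suc_Diff1[of "nodes t" "[]"] by simp
qed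

lemma num_edges_Node: "num_edges (Node ts) = (\<Sum>t\<leftarrow>ts. num_edges t + 1)"
proof -
  have "Suc (num_edges (Node ts)) = Suc (\<Sum>i<length ts. card (nodes (ts ! i)))"
    unfolding num_edges_nodes nodes_Node
    by (subst card_insert_disjoint) (auto simp: finite_nodes card_UN_Cons)
  thus ?thesis by (simp add: num_edges_nodes [symmetric] sum_list_sum_nth atLeast0LessThan)
qed

lemma leaves_Node:
  "leaves (Node ts) = (if ts = [] then {[]} else (\<Union>i<length ts. (#) i ` leaves (ts ! i)))"
proof (rule set_eqI)
  fix p
  show "p \<in> leaves (Node ts) \<longleftrightarrow>
    p \<in> (if ts = [] then {[]} else (\<Union>i<length ts. (#) i ` leaves (ts ! i)))"
    by (cases p) (auto simp: leaves_def)
qed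

lemma num_leaves_Node:
  "num_leaves (Node ts) = (if ts = [] then 1 else (\<Sum>t\<leftarrow>ts. num_leaves t))"
  by (simp add: num_leaves_def leaves_Node card_UN_Cons finite_leaves sum_list_sum_nth
      atLeast0LessThan)

definition forests :: "nat \<Rightarrow> plane_tree list set" where
  "forests n = {ts. (\<Sum>t\<leftarrow>ts. num_edges t + 1) = n}"

lemma trees_forests: "{t. num_edges t = n} = Node ` forests n"
proof (rule set_eqI)
  fix t show "t \<in> {t. num_edges t = n} \<longleftrightarrow> t \<in> Node ` forests n"
    by (cases t) (auto simp: forests_def num_edges_Node)
qed

lemma forests_0: "forests 0 = {[]}" by (auto simp: forests_def)

lemma forests_Suc:
  "forests (Suc n) =
    (\<Union>i\<in>{..n}. (\<lambda>(t, ts). t # ts) ` ({t. num_edges t = i} \<times> forests (n - i)))"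
proof (rule set_eqI)
  fix ts
  show "ts \<in> forests (Suc n) \<longleftrightarrow>
    ts \<in> (\<Union>i\<in>{..n}. (\<lambda>(t, ts). t # ts) ` ({t. num_edges t = i} \<times> forests (n - i)))"
  proof (cases ts)
    case Nil thus ?thesis by (auto simp: forests_def)
  next
    case (Cons t us)
    have "ts \<in> forests (Suc n) \<longleftrightarrow> num_edges t \<le> n \<and> us \<in> forests (n - num_edges t)"
      by (auto simp: forests_def Cons)
    thus ?thesis by (auto simp: Cons image_iff)
  qed
qed

lemma finite_forests: "finite (forests n)"
proof (induction n rule: less_induct)
  case (less n)
  show ?case
  proof (cases n)
    case (Suc m)
    have "finite (forests i)" if "i \<le> m" for i
      using less Suc that by simp
    thus ?thesis
      unfolding Suc forests_Suc trees_forests by (auto intro!: finite_imageI finite_cartesian_product)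
  qed (simp add: forests_0)
qed

lemma finite_trees: "finite {t. num_edges t = n}"
  by (simp add: trees_forests finite_forests)

definition forest_gf :: "'a::comm_ring_1 \<Rightarrow> 'a fps" where
  "forest_gf u = Abs_fps (\<lambda>n. \<Sum>ts\<in>forests n. u ^ (\<Sum>t\<leftarrow>ts. num_leaves t))"

lemma N_forest_gf: "N u = fps_const u + forest_gf u - 1"
proof (rule fps_ext)
  fix n
  have "N u $ n = (\<Sum>ts\<in>forests n. u ^ num_leaves (Node ts))"
    unfolding N_def by (simp add: trees_forests, subst sum.reindex) (auto simp: inj_on_def)
  also have "\<dots> = (fps_const u + forest_gf u - 1) $ n"
  proof (cases n)
    case 0 thus ?thesis by (simp add: forests_0 forest_gf_def num_leaves_Node)
  next
    case (Suc m)
    have "[] \<notin> forests n" by (auto simp: forests_def Suc)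
    thus ?thesis using Suc
      by (auto simp: forest_gf_def num_leaves_Node intro!: sum.cong)
  qed
  finally show "N u $ n = (fps_const u + forest_gf u - 1) $ n" .
qed

lemma forest_gf_eq: "forest_gf u = 1 + fps_X * N u * forest_gf u"
proof (rule fps_ext)
  fix n show "forest_gf u $ n = (1 + fps_X * N u * forest_gf u) $ n"
  proof (cases n)
    case 0 thus ?thesis by (simp add: forests_0 forest_gf_def)
  next
    case (Suc m)
    have "forest_gf u $ n =
      (\<Sum>i\<le>m. \<Sum>ts\<in>(\<lambda>(t, ts). t # ts) ` ({t. num_edges t = i} \<times> forests (m - i)).
      u ^ (\<Sum>t\<leftarrow>ts. num_leaves t))"
      unfolding forest_gf_def Suc fps_nth_Abs_fps forests_Suc
      by (subst sum.UNION_disjoint) (auto simp: finite_trees finite_forests)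
    also have "\<dots> =
      (\<Sum>i\<le>m. (\<Sum>t | num_edges t = i. u ^ num_leaves t) *
      (\<Sum>ts\<in>forests (m - i). u ^ (\<Sum>t\<leftarrow>ts. num_leaves t)))"
      by (rule sum.cong[OF refl], subst sum.reindex)
         (auto simp: inj_on_def power_add sum_product sum.cartesian_product intro!: sum.cong)
    also have "\<dots> = (N u * forest_gf u) $ m"
      by (simp add: fps_mult_nth N_def forest_gf_def atMost_atLeast0)
    finally show ?thesis by (simp add: Suc mult.assoc)
  qed
qed

text \<open>
  The usual closed form: \<open>2 z N(u, z) = 1 - (1 - u) z - S\<close>, where \<open>S\<close> is the square root of
  \<open>1 - 2 (1 + u) z + (1 - u)\<^sup>2 z\<^sup>2\<close> with constant term \<open>1\<close>.
\<close>

theorem N_closed_form: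
  fixes u :: "'a::comm_ring_1"
  defines "S \<equiv> 1 - fps_const (1 - u) * fps_X - 2 * fps_X * N u"
  shows "S ^ 2 = 1 - 2 * fps_const (1 + u) * fps_X + fps_const (1 - u) ^ 2 * fps_X ^ 2"
    and "S $ 0 = 1"
proof -
  have 1: "forest_gf u = N u - fps_const u + 1" by (simp add: N_forest_gf)
  have 2: "fps_const (1 - u) = 1 - fps_const u" "fps_const (1 + u) = 1 + fps_const u"
    by (metis fps_const_1_eq_1 fps_const_sub, metis fps_const_1_eq_1 fps_const_add)
  have 3: "N u = fps_const u + fps_X * N u * (N u - fps_const u + 1)"
    using forest_gf_eq[of u] unfolding 1 by (simp add: algebra_simps)
  have "(1 - (1 - c) * x - 2 * x * n) ^ 2 =
      1 - 2 * (1 + c) * x + (1 - c) ^ 2 * x ^ 2 - 4 * x * (n - (c + x * n * (n - c + 1)))"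
    for c x n :: "'a fps"
    by (simp add: algebra_simps power2_eq_square)
  from this[of "fps_const u" fps_X "N u"]
  show "S ^ 2 = 1 - 2 * fps_const (1 + u) * fps_X + fps_const (1 - u) ^ 2 * fps_X ^ 2"
    unfolding S_def 2 using 3 by simp
  show "S $ 0 = 1" by (simp add: S_def)
qed

text \<open>
  On the iterated ring, which is not over a field, \<open>/\<close> still is division by a unit for
  denominators of the following form.
\<close>

lemma divide_series_vxyz:
  fixes a b c :: series_vxyz
  shows "(a / (1 - fps_const var_y * fps_X * b * c)) * (1 - fps_const var_y * fps_X * b * c) = a"
proof -
  define g where "g = 1 - fps_const var_y * fps_X * b * c"
  have 0: "g $ 0 = 1" by (simp add: g_def)
  have 1: "g $ 0 * inverse (g $ 0) = 1" unfolding 0 by (simp add: fps_inverse_one')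
  have 2: "a / g = a * inverse g" using 0 by (intro fps_divide_unit) simp
  have "g * inverse g = 1"
    using fps_right_inverse[of g "inverse (g $ 0)"] 1 by (simp only: fps_inverse_def)
  hence "inverse g * g = 1" by (simp only: mult.commute)
  hence "a / g * g = a" by (simp add: 2 mult.assoc)
  thus ?thesis unfolding g_def .
qed

end

end

theory Submission
  imports Defs
begin

text \<open>
  Call a plane tree with a distinguished leaf a marked tree. Its weight is
  \<open>v\<^sup>k x\<^sup>r y\<^sup>d\<close>, where \<open>k\<close> is the number of leaves, \<open>r\<close> the number of leaves to the left of the
  distinguished one and \<open>d\<close> the depth of the distinguished leaf. Every tree with \<open>k\<close> leaves has
  exactly one leaf of index \<open>r\<close> for each \<open>r < k\<close>, so \<open>P\<close> enumerates marked trees by weight and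
  number of edges (\<open>P_eq_marked_gf\<close>).

  A marked tree is either a single node, of weight \<open>v\<close>, or it splits at the child of the root
  that lies on the path to the distinguished leaf: the subtree at that child is again a marked tree, to its left and to its
  right there are arbitrary forests (\<open>marked_trees_eq\<close>). The edge to that child contributes \<open>y z\<close>.
  A leaf of the left forest precedes the distinguished leaf and contributes \<open>v x\<close>, a leaf of the
  right forest contributes only \<open>v\<close>. With \<open>F(u) = N(u, z) - u + 1\<close>, the generating function of
  forests, this says
  \<open>P = v + y z F(v x) P F(v)\<close>,
  which is linear in \<open>P\<close>, and the coefficient \<open>1 - y z F(v x) F(v)\<close> is a unit because its
  constant term in \<open>z\<close> is \<open>1\<close>.
\<close>

section \<open>Generating functions of weighted classes\<close>

context includes fps_syntax
begin

definition class_gf :: "'b set \<Rightarrow> ('b \<Rightarrow> nat) \<Rightarrow> ('b \<Rightarrow> 'a::comm_ring_1) \<Rightarrow> 'a fps" where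
  "class_gf A sz wt = Abs_fps (\<lambda>n. \<Sum>a | a \<in> A \<and> sz a = n. wt a)"

lemma class_gf_times:
  assumes A: "\<And>n. finite {a \<in> A. sa a = n}" and B: "\<And>n. finite {b \<in> B. sb b = n}"
  shows "class_gf (A \<times> B) (\<lambda>(a, b). sa a + sb b) (\<lambda>(a, b). wa a * wb b) =
    class_gf A sa wa * class_gf B sb wb"
proof (rule fps_ext)
  fix n
  have "{c \<in> A \<times> B. (case c of (a, b) \<Rightarrow> sa a + sb b) = n} =
      (\<Union>i\<in>{0..n}. {a \<in> A. sa a = i} \<times> {b \<in> B. sb b = n - i})"
    by auto
  hence "class_gf (A \<times> B) (\<lambda>(a, b). sa a + sb b) (\<lambda>(a, b). wa a * wb b) $ n =
      (\<Sum>i=0..n. \<Sum>(a, b)\<in>{a \<in> A. sa a = i} \<times> {b \<in> B. sb b = n - i}. wa a * wb b)"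
    unfolding class_gf_def fps_nth_Abs_fps
    by (simp only:) (subst sum.UNION_disjoint, use A B in \<open>auto simp: finite_cartesian_product\<close>)
  also have "\<dots> = (class_gf A sa wa * class_gf B sb wb) $ n"
    by (simp add: class_gf_def fps_mult_nth sum_product sum.cartesian_product)
  finally show "class_gf (A \<times> B) (\<lambda>(a, b). sa a + sb b) (\<lambda>(a, b). wa a * wb b) $ n =
      (class_gf A sa wa * class_gf B sb wb) $ n" .
qed

lemma finite_size_fibre_times:
  fixes sa :: "'a \<Rightarrow> nat"
  assumes A: "\<And>n. finite {a \<in> A. sa a = n}" and B: "\<And>n. finite {b \<in> B. sb b = n}"
  shows "finite {c \<in> A \<times> B. (case c of (a, b) \<Rightarrow> sa a + sb b) = n}"
proof (rule finite_subset)
  show "{c \<in> A \<times> B. (case c of (a, b) \<Rightarrow> sa a + sb b) = n} \<subseteq>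
      (\<Union>i\<in>{0..n}. {a \<in> A. sa a = i} \<times> {b \<in> B. sb b = n - i})"
    by auto
qed (use A B in auto)


section \<open>Trees with a distinguished leaf\<close>

definition leaf_index :: "plane_tree \<Rightarrow> nat list \<Rightarrow> nat" where
  "leaf_index t p = card {q \<in> leaves t. q < p}"

definition marked_trees :: "(plane_tree \<times> nat list) set" where
  "marked_trees = {(t, p). p \<in> leaves t}"

definition marked_weight :: "plane_tree \<times> nat list \<Rightarrow> coeff_vxy" where
  "marked_weight = (\<lambda>(t, p). var_v ^ num_leaves t * var_x ^ leaf_index t p * var_y ^ depth p)"

abbreviation marked_size :: "plane_tree \<times> nat list \<Rightarrow> nat" where
  "marked_size \<equiv> \<lambda>(t, p). num_edges t"

lemma finite_marked_trees: "finite {m \<in> marked_trees. marked_size m = n}"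
proof (rule finite_subset)
  show "{m \<in> marked_trees. marked_size m = n} \<subseteq> (SIGMA t:{t. num_edges t = n}. leaves t)"
    by (auto simp: marked_trees_def)
qed (simp add: finite_trees finite_leaves)

lemma nth_leaf_bij: "bij_betw (nth_leaf t) {..<num_leaves t} (leaves t)"
  unfolding nth_leaf_def
  by (rule bij_betw_nth) (simp_all add: finite_leaves num_leaves_def)

lemma leaf_index_nth_leaf:
  assumes "r < num_leaves t"
  shows "leaf_index t (nth_leaf t r) = r"
proof -
  \<comment> \<open>In a strictly sorted list, exactly the first \<open>r\<close> entries are smaller than the entry at \<open>r\<close>.\<close>
  define xs where "xs = sorted_list_of_set (leaves t)"
  have xs: "sorted_wrt (<) xs" "set xs = leaves t" "length xs = num_leaves t"
    by (simp_all add: xs_def finite_leaves num_leaves_def)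
  have less: "xs ! i < xs ! j \<longleftrightarrow> i < j" if "i < length xs" "j < length xs" for i j
    using sorted_wrt_nth_less[OF xs(1), of i j] sorted_wrt_nth_less[OF xs(1), of j i] that
    by (cases i j rule: linorder_cases) auto
  have "{q \<in> leaves t. q < xs ! r} = {xs ! i | i. i < length xs \<and> xs ! i < xs ! r}"
    unfolding xs(2)[symmetric] set_conv_nth by blast
  also have "\<dots> = {xs ! i | i. i < r}"
    using assms less xs(3) by (metis order.strict_trans)
  also have "\<dots> = (!) xs ` {..<r}"
    by blast
  finally have "{q \<in> leaves t. q < xs ! r} = (!) xs ` {..<r}" .
  moreover have "inj_on ((!) xs) {..<r}"
    using assms xs(3) by (auto simp: xs_def inj_on_def nth_eq_iff_index_eq)
  ultimately show ?thesis
    by (simp add: leaf_index_def nth_leaf_def xs_def[symmetric] card_image)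
qed

lemma monomial_vxy_nth:
  "(var_v ^ k * var_x ^ r * var_y ^ d) $ d' $ r' $ k' = (if d' = d \<and> r' = r \<and> k' = k then 1 else 0)"
proof -
  have "var_v ^ k * var_x ^ r * var_y ^ d =
      fps_const (fps_const (fps_X ^ k) * fps_X ^ r) * fps_X ^ d"
    by (simp add: var_v_def var_x_def var_y_def fps_const_power)
  thus ?thesis by (simp add: fps_X_power_iff)
qed

text \<open>
  Both sides count the same pairs: a tree has at most one leaf of index \<open>r\<close>, so counting trees
  whose leaf of index \<open>r\<close> has depth \<open>d\<close> amounts to counting marked trees.
\<close>

lemma P_eq_marked_gf: "P = class_gf marked_trees marked_size marked_weight"
proof (intro fps_ext)
  fix n d r k
  let ?T = "{t. num_edges t = n}"
  have inner: "(\<Sum>p\<in>leaves t. marked_weight (t, p) $ d $ r $ k) =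
      (if num_leaves t = k \<and> r < k \<and> depth (nth_leaf t r) = d then 1 else 0)" for t
  proof -
    have "(\<Sum>p\<in>leaves t. marked_weight (t, p) $ d $ r $ k) =
        (\<Sum>s<num_leaves t. marked_weight (t, nth_leaf t s) $ d $ r $ k)"
      by (rule sum.reindex_bij_betw[OF nth_leaf_bij, symmetric])
    also have "\<dots> = (\<Sum>s<num_leaves t. if s = r then
        (if num_leaves t = k \<and> depth (nth_leaf t r) = d then 1 else 0) else 0)"
      by (intro sum.cong) (auto simp: marked_weight_def monomial_vxy_nth leaf_index_nth_leaf)
    finally show ?thesis by auto
  qed
  have "{m \<in> marked_trees. marked_size m = n} = (SIGMA t:?T. leaves t)"
    by (auto simp: marked_trees_def)
  hence "class_gf marked_trees marked_size marked_weight $ n =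
      (\<Sum>t\<in>?T. \<Sum>p\<in>leaves t. marked_weight (t, p))"
    by (simp add: class_gf_def sum.Sigma finite_trees finite_leaves)
  hence "class_gf marked_trees marked_size marked_weight $ n $ d $ r $ k =
      (\<Sum>t\<in>?T. \<Sum>p\<in>leaves t. marked_weight (t, p) $ d $ r $ k)"
    by (simp add: fps_sum_nth)
  also have "\<dots> = of_nat (card {t \<in> ?T. num_leaves t = k \<and> r < k \<and> depth (nth_leaf t r) = d})"
    by (simp add: inner finite_trees sum.If_cases Int_def)
  finally show "P $ n $ d $ r $ k = class_gf marked_trees marked_size marked_weight $ n $ d $ r $ k"
    by (simp add: P_def)
qed


section \<open>Splitting at the child below which the distinguished leaf lies\<close>

definition graft ::
  "(plane_tree list \<times> plane_tree \<times> nat list) \<times> plane_tree list \<Rightarrow> plane_tree \<times> nat list" where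
  "graft = (\<lambda>((us, t, p), ws). (Node (us @ t # ws), length us # p))"

lemma inj_graft: "inj graft"
  by (auto simp: graft_def inj_on_def)

lemma marked_trees_eq:
  "marked_trees = insert (Node [], []) (graft ` ((UNIV \<times> marked_trees) \<times> UNIV))"
proof (intro equalityI subsetI)
  fix m assume m: "m \<in> marked_trees"
  obtain ts p where [simp]: "m = (Node ts, p)"
    by (metis plane_tree.exhaust surj_pair)
  show "m \<in> insert (Node [], []) (graft ` ((UNIV \<times> marked_trees) \<times> UNIV))"
  proof (cases "ts = []")
    case True
    thus ?thesis using m by (simp add: marked_trees_def leaves_Node)
  next
    case False
    then obtain i q where *: "p = i # q" "i < length ts" "q \<in> leaves (ts ! i)"
      using m by (auto simp: marked_trees_def leaves_Node)
    hence "m = graft ((take i ts, ts ! i, q), drop (Suc i) ts)"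
      by (simp add: graft_def id_take_nth_drop[symmetric])
    with * show ?thesis by (auto simp: marked_trees_def)
  qed
next
  fix m assume "m \<in> insert (Node [], []) (graft ` ((UNIV \<times> marked_trees) \<times> UNIV))"
  thus "m \<in> marked_trees"
    by (force simp: marked_trees_def graft_def leaves_Node)
qed

text \<open>
  In the lexicographic order, the leaves before a leaf below the child \<open>t\<close> are all those below the
  children left of \<open>t\<close>, and those below \<open>t\<close> itself that already precede it there.
\<close>

lemma leaf_index_graft:
  "leaf_index (Node (us @ t # ws)) (length us # p) = (\<Sum>u\<leftarrow>us. num_leaves u) + leaf_index t p"
proof -
  let ?ts = "us @ t # ws"
  let ?A = "\<lambda>j. if j < length us then leaves (us ! j) else {q \<in> leaves t. q < p}"
  have Cons_mem: "a # q \<in> (\<Union>j<n. (#) j ` B j) \<longleftrightarrow> a < n \<and> q \<in> B a"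
    for a n :: nat and q B
    by auto
  have "q \<in> leaves (Node ?ts) \<and> q < length us # p \<longleftrightarrow>
      q \<in> (\<Union>j<Suc (length us). (#) j ` ?A j)" for q
  proof (cases q)
    case Nil
    thus ?thesis by (auto simp: leaves_Node)
  next
    case (Cons a q')
    \<comment> \<open>Unions stay folded so that \<open>Cons_mem\<close> picks the only child that can contain the address.\<close>
    thus ?thesis
      unfolding Cons Cons_mem leaves_Node by (auto simp: Cons_mem nth_append simp del: UN_iff)
  qed
  hence "{q \<in> leaves (Node ?ts). q < length us # p} = (\<Union>j<Suc (length us). (#) j ` ?A j)"
    by blast
  hence "leaf_index (Node ?ts) (length us # p) = (\<Sum>j<Suc (length us). card (?A j))"
    unfolding leaf_index_def by (simp only:) (subst card_UN_Cons, auto simp: finite_leaves)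
  thus ?thesis
    by (simp add: leaf_index_def num_leaves_def sum_list_sum_nth atLeast0LessThan)
qed

abbreviation forest_size :: "plane_tree list \<Rightarrow> nat" where
  "forest_size ts \<equiv> \<Sum>t\<leftarrow>ts. num_edges t + 1"

abbreviation forest_weight :: "'a \<Rightarrow> plane_tree list \<Rightarrow> 'a::comm_ring_1" where
  "forest_weight u ts \<equiv> u ^ (\<Sum>t\<leftarrow>ts. num_leaves t)"

lemma marked_size_graft:
  "marked_size (graft ((us, m), ws)) = Suc (forest_size us + marked_size m + forest_size ws)"
  by (cases m) (simp add: graft_def num_edges_Node)

lemma marked_weight_graft:
  "marked_weight (graft ((us, m), ws)) =
    var_y * (forest_weight (var_v * var_x) us * marked_weight m * forest_weight var_v ws)"
  by (cases m) (simp add: graft_def marked_weight_def leaf_index_graft num_leaves_Node depth_def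
      power_add power_mult_distrib ac_simps)

lemma forest_gf_class: "forest_gf u = class_gf UNIV forest_size (forest_weight u)"
  by (simp add: forest_gf_def class_gf_def forests_def)

text \<open>
  Grafting is injective and reaches every marked tree with at least one edge; since it multiplies
  weights up to the factor \<open>var_y\<close> and adds sizes up to one extra edge, its domain
  contributes a product of generating functions. The term \<open>var_v\<close> is the single node, which is
  its own only leaf.
\<close>

lemma marked_gf_recursion:
  fixes M :: series_vxyz
  defines "M \<equiv> class_gf marked_trees marked_size marked_weight"
  shows "M = fps_const var_v +
    fps_X * (fps_const var_y * (forest_gf (var_v * var_x) * M * forest_gf var_v))"
proof (rule fps_ext)
  let ?D = "(UNIV \<times> marked_trees) \<times> (UNIV :: plane_tree list set)"
  let ?size = "\<lambda>(a, ws). (case a of (us, m) \<Rightarrow> forest_size us + marked_size m) + forest_size ws"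
  let ?wt = "\<lambda>(a, ws). (case a of (us, m) \<Rightarrow>
    forest_weight (var_v * var_x) us * marked_weight m) * forest_weight var_v ws"
  have size_graft: "marked_size (graft c) = Suc (?size c)" for c
    using marked_size_graft[of "fst (fst c)" "snd (fst c)" "snd c"]
    unfolding case_prod_beta prod.collapse .
  have weight_graft: "marked_weight (graft c) = var_y * ?wt c" for c
    using marked_weight_graft[of "fst (fst c)" "snd (fst c)" "snd c"]
    unfolding case_prod_beta prod.collapse .
  have forests: "finite {ts \<in> UNIV. forest_size ts = n}" for n
    using finite_forests[of n] by (simp add: forests_def)
  have prod: "class_gf ?D ?size ?wt = forest_gf (var_v * var_x) * M * forest_gf var_v"
    unfolding M_def forest_gf_class
    by (subst class_gf_times, rule finite_size_fibre_times[OF forests finite_marked_trees],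
        rule forests, subst class_gf_times[OF forests finite_marked_trees], rule refl)
  fix n
  show "M $ n = (fps_const var_v +
    fps_X * (fps_const var_y * (forest_gf (var_v * var_x) * M * forest_gf var_v))) $ n"
  proof (cases n)
    case 0
    have "{m \<in> marked_trees. marked_size m = 0} = {(Node [], [])}"
      by (subst marked_trees_eq) (auto simp: num_edges_Node graft_def)
    thus ?thesis
      by (simp add: 0 M_def class_gf_def marked_weight_def num_leaves_Node leaf_index_def
          leaves_Node depth_def)
  next
    case (Suc l)
    have "{m \<in> marked_trees. marked_size m = n} = graft ` {c \<in> ?D. ?size c = l}"
    proof -
      have "{m \<in> marked_trees. marked_size m = n} = {m \<in> graft ` ?D. marked_size m = Suc l}"
        by (subst marked_trees_eq) (auto simp: num_edges_Node Suc)
      also have "\<dots> = graft ` {c \<in> ?D. marked_size (graft c) = Suc l}"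
        by blast
      also have "{c \<in> ?D. marked_size (graft c) = Suc l} = {c \<in> ?D. ?size c = l}"
        by (simp only: size_graft nat.inject)
      finally show ?thesis .
    qed
    hence "M $ n = (\<Sum>c | c \<in> ?D \<and> ?size c = l. marked_weight (graft c))"
      by (simp add: M_def class_gf_def sum.reindex inj_on_subset[OF inj_graft])
    also have "\<dots> = (\<Sum>c | c \<in> ?D \<and> ?size c = l. var_y * ?wt c)"
      by (simp only: weight_graft)
    also have "\<dots> = var_y * (forest_gf (var_v * var_x) * M * forest_gf var_v) $ l"
      by (simp only: prod[symmetric] class_gf_def fps_nth_Abs_fps sum_distrib_left)
    finally show ?thesis by (simp add: Suc)
  qed
qed

end

theorem theorem4p1:
  "P = fps_const var_v /
     (1 - fps_const var_y * fps_X *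
            (N (var_v * var_x) - fps_const (var_v * var_x) + 1) *
            (N var_v - fps_const var_v + 1))"
proof -
  let ?F = "\<lambda>u. N u - fps_const u + 1"
  let ?g = "1 - fps_const var_y * fps_X * ?F (var_v * var_x) * ?F var_v"
  have F: "forest_gf u = ?F u" for u :: coeff_vxy
    by (simp add: N_forest_gf)
  have "P * ?g = fps_const var_v"
    using marked_gf_recursion unfolding P_eq_marked_gf[symmetric] F
    by (simp only: algebra_simps mult_1_right mult_1_left)
  hence "P * ?g = fps_const var_v / ?g * ?g"
    by (simp only: divide_series_vxyz)
  moreover have "fps_nth ?g 0 = 1" by simp
  hence "?g \<noteq> 0" by (metis fps_zero_nth zero_neq_one)
  ultimately show ?thesis
    by (simp only: mult_cancel_right) simp
qed

end
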